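(* Let $n\ge 2$ with $n\neq 4,7$, and let $\mathbb{P}_n$ be the path on $n$ vertices. Then $\mathbb{P}_n$ is a compliant graph.
   Context: Let $G$ be a graph without isolated vertices. A total dominating set (TDS) of $G$ is a set $S\subseteq V(G)$ such that every vertex of $G$ (including those in $S$) is adjacent to some vertex of $S$. A TDS $S$ is a minimal TDS (MTDS) if no proper subset of $S$ is a TDS. A vertex $a$ of $G$ is compliant if there exists an MTDS of $G$ containing $a$; $G$ is a compliant graph if every vertex of $G$ is compliant. *)

theory Defs
  imports "Graph_Theory.Pair_Digraph"
begin

text \<open>A finite simple graph is a \<^locale>\<open>pair_graph\<close>: finite, loop-free and symmetric, so that an
  edge between \<open>u\<close> and \<open>v\<close> is represented by the two arcs \<open>(u, v)\<close> and \<open>(v, u)\<close>.\<close>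

definition no_isolated_vertices :: "'a pair_pre_digraph \<Rightarrow> bool" where
  "no_isolated_vertices G \<longleftrightarrow> (\<forall>v \<in> pverts G. \<exists>u \<in> pverts G. (v, u) \<in> parcs G)"

definition total_dominating_set :: "'a pair_pre_digraph \<Rightarrow> 'a set \<Rightarrow> bool" where
  "total_dominating_set G S \<longleftrightarrow>
     S \<subseteq> pverts G \<and> (\<forall>v \<in> pverts G. \<exists>u \<in> S. (v, u) \<in> parcs G)"

definition minimal_total_dominating_set :: "'a pair_pre_digraph \<Rightarrow> 'a set \<Rightarrow> bool" where
  "minimal_total_dominating_set G S \<longleftrightarrow>
     total_dominating_set G S \<and> (\<forall>T. T \<subset> S \<longrightarrow> \<not> total_dominating_set G T)"

definition compliant_vertex :: "'a pair_pre_digraph \<Rightarrow> 'a \<Rightarrow> bool" where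
  "compliant_vertex G a \<longleftrightarrow>
     a \<in> pverts G \<and> (\<exists>S. minimal_total_dominating_set G S \<and> a \<in> S)"

text \<open>The standing assumption that \<open>G\<close> is a graph without isolated vertices is part of the
  definition, so it has to be established wherever compliance is claimed.\<close>

definition compliant_graph :: "'a pair_pre_digraph \<Rightarrow> bool" where
  "compliant_graph G \<longleftrightarrow>
     pair_graph G \<and> no_isolated_vertices G \<and> (\<forall>a \<in> pverts G. compliant_vertex G a)"

definition path_graph :: "nat \<Rightarrow> nat pair_pre_digraph" where
  "path_graph n =
     \<lparr>pverts = {1..n},
      parcs = {(i, i + 1) | i. 1 \<le> i \<and> i < n} \<union> {(i + 1, i) | i. 1 \<le> i \<and> i < n}\<rparr>"

lemma pair_graph_path_graph: "pair_graph (path_graph n)"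
proof -
  have fin: "finite (parcs (path_graph n))"
    by (rule finite_subset[of _ "{1..n} \<times> {1..n}"]) (auto simp: path_graph_def)
  show ?thesis
    by unfold_locales
      (use fin in \<open>auto simp: path_graph_def arcs_ends_def symmetric_def sym_def arc_to_ends_def\<close>)
qed

lemma no_isolated_vertices_path_graph:
  assumes "n \<ge> 2"
  shows "no_isolated_vertices (path_graph n)"
  unfolding no_isolated_vertices_def
proof
  fix v assume v: "v \<in> pverts (path_graph n)"
  show "\<exists>u \<in> pverts (path_graph n). (v, u) \<in> parcs (path_graph n)"
  proof (cases "v < n")
    case True
    then show ?thesis using v by (intro bexI[of _ "v + 1"]) (auto simp: path_graph_def)
  next
    case False
    then show ?thesis using v assms
      by (intro bexI[of _ "v - 1"]) (auto simp: path_graph_def intro!: exI[of _ "v - 1"])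
  qed
qed

end

theory Submission
  imports Defs
begin

text \<open>A vertex \<open>a\<close> is compliant as soon as it has a neighbour \<open>v\<close> such that removing all neighbours
  of \<open>v\<close> other than \<open>a\<close> leaves a total dominating set: every minimal total dominating set inside
  it must contain \<open>a\<close>, which alone dominates \<open>v\<close>. In a path at most one vertex \<open>b\<close> is removed, at
  distance two from \<open>a\<close>, and this is harmless unless \<open>b\<close> is \<open>2\<close> or \<open>n - 1\<close>, the sole neighbour of
  an end vertex. Both choices of \<open>b\<close> fail only if \<open>a \<in> {1, 4} \<inter> {n - 3, n}\<close>, which
  forces \<open>n = 4\<close> or \<open>n = 7\<close> (or \<open>n = 1\<close>).\<close>

text \<open>By finiteness \<open>?F\<close> has an inclusion-minimal member; it is minimal outright,
  as its subsets stay inside \<open>S\<close>.\<close>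

lemma ex_minimal_total_dominating_subset:
  assumes "finite (pverts G)" and "total_dominating_set G S"
  obtains T where "T \<subseteq> S" and "minimal_total_dominating_set G T"
proof -
  let ?F = "{T. T \<subseteq> S \<and> total_dominating_set G T}"
  have "finite S"
    using assms finite_subset unfolding total_dominating_set_def by blast
  then have "finite ?F" by simp
  moreover have "S \<in> ?F" using assms(2) by simp
  ultimately obtain T where "T \<in> ?F" and "\<forall>U \<in> ?F. U \<subseteq> T \<longrightarrow> T = U"
    using finite_has_minimal2[of ?F S] by auto
  then have "T \<subseteq> S" and "minimal_total_dominating_set G T"
    by (auto simp: minimal_total_dominating_set_def)
  then show thesis by (rule that)
qed

lemma compliant_vertexI:
  assumes "finite (pverts G)" and "a \<in> pverts G" and "v \<in> pverts G"
    and dom: "\<And>w. w \<in> pverts G \<Longrightarrow>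
      \<exists>u \<in> pverts G. (w, u) \<in> parcs G \<and> ((v, u) \<in> parcs G \<longrightarrow> u = a)"
  shows "compliant_vertex G a"
proof -
  let ?S = "{u \<in> pverts G. (v, u) \<in> parcs G \<longrightarrow> u = a}"
  have "total_dominating_set G ?S"
    using dom by (fastforce simp: total_dominating_set_def)
  with assms(1) obtain T where T: "T \<subseteq> ?S" "minimal_total_dominating_set G T"
    by (rule ex_minimal_total_dominating_subset)
  then obtain u where "u \<in> T" "(v, u) \<in> parcs G"
    using \<open>v \<in> pverts G\<close>
    by (auto simp: minimal_total_dominating_set_def total_dominating_set_def)
  with T have "a \<in> T" by auto
  with T \<open>a \<in> pverts G\<close> show ?thesis by (auto simp: compliant_vertex_def)
qed

lemma pverts_path_graph [simp]: "pverts (path_graph n) = {1..n}"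
  by (simp add: path_graph_def)

lemma parcs_path_graph_iff:
  "(i, j) \<in> parcs (path_graph n) \<longleftrightarrow>
    i \<in> {1..n} \<and> j \<in> {1..n} \<and> (j = i + 1 \<or> i = j + 1)"
  by (auto simp: path_graph_def)

lemma compliant_vertex_path_graph:
  assumes "a \<in> {1..n}" and "v \<in> {1..n}" and "n \<ge> 2"
    and adj: "(v = a + 1 \<and> v + 2 \<noteq> n) \<or> (a = v + 1 \<and> v \<noteq> 3)"
  shows "compliant_vertex (path_graph n) a"
proof (rule compliant_vertexI)
  fix w assume "w \<in> pverts (path_graph n)"
  then have w: "1 \<le> w" "w \<le> n" by auto
  show "\<exists>u \<in> pverts (path_graph n). (w, u) \<in> parcs (path_graph n) \<and>
      ((v, u) \<in> parcs (path_graph n) \<longrightarrow> u = a)"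
    using adj
  proof
    assume "v = a + 1 \<and> v + 2 \<noteq> n"
    \<comment> \<open>Only \<open>v + 1\<close> is removed. The right neighbour \<open>w + 1\<close>
      hits it just for \<open>w = v\<close>, where \<open>a = v - 1\<close> serves;
      \<open>w = n\<close> must use \<open>n - 1\<close>, which differs from
      \<open>v + 1\<close>.\<close>
    with assms w show ?thesis
      by (intro bexI[of _ "if w = v \<or> w = n then w - 1 else w + 1"])
        (auto simp: parcs_path_graph_iff)
  next
    assume "a = v + 1 \<and> v \<noteq> 3"
    \<comment> \<open>Mirror image: \<open>v - 1\<close> is removed, and \<open>w = 1\<close> must
      use \<open>2\<close>, kept since \<open>v \<noteq> 3\<close>.\<close>
    with assms w show ?thesis
      by (intro bexI[of _ "if w = v \<or> w = 1 then w + 1 else w - 1"])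
        (auto simp: parcs_path_graph_iff)
  qed
qed (use assms in auto)

theorem theorem3:
  fixes n :: nat
  assumes "n \<ge> 2" and "n \<noteq> 4" and "n \<noteq> 7"
  shows "compliant_graph (path_graph n)"
  unfolding compliant_graph_def
proof (intro conjI ballI)
  fix a assume "a \<in> pverts (path_graph n)"
  then have a: "1 \<le> a" "a \<le> n" by auto
  \<comment> \<open>The side conditions \<open>v + 2 \<noteq> n\<close> and
    \<open>v \<noteq> 3\<close>, rewritten for \<open>v = a + 1\<close> and
    \<open>v = a - 1\<close>.\<close>
  let ?v_above = "a + 1 \<le> n \<and> a + 3 \<noteq> n" and ?v_below = "2 \<le> a \<and> a \<noteq> 4"
  from a assms consider ?v_above | ?v_below by linarith
  then show "compliant_vertex (path_graph n) a"
  proof cases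
    case 1
    with a assms show ?thesis
      by (intro compliant_vertex_path_graph[where v = "a + 1"]) auto
  next
    case 2
    with a assms show ?thesis
      by (intro compliant_vertex_path_graph[where v = "a - 1"]) auto
  qed
qed (use assms in \<open>simp_all add: pair_graph_path_graph no_isolated_vertices_path_graph\<close>)

end
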